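(* Every complete body of diameter $\delta$ in the $d$-dimensional hyperbolic space $\mathbb{H}^d$ is a body of constant width $\delta$.
   Context: $\mathbb{H}^d$ is the $d$-dimensional hyperbolic space. A convex body is a compact convex set with non-empty interior. Hyperplanes are $(d-1)$-dimensional totally geodesic subspaces. Complete: a set $C \subset \mathbb{H}^d$ of diameter $\delta$ is complete provided $\mathrm{diam}(C \cup \{x\}) > \delta$ for every $x \notin C$. A complete body is a convex body which is a complete set. Width: for a hyperplane $H$ supporting a convex body $C \subset \mathbb{H}^d$, the width of $C$ determined by $H$, denoted $\mathrm{width}_H(C)$, is the distance between $H$ and any farthest hyperplane supporting $C$ that is ultraparallel to $H$. Constant width: a convex body $W \subset \mathbb{H}^d$ is a body of constant width $\delta$ if $\mathrm{width}_H(W) = \delta$ for every hyperplane $H$ supporting $W$. *)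

theory Defs
  imports "HOL-Analysis.Analysis"
begin

section \<open>Hyperbolic space: the hyperboloid model\<close>

definition lorentz :: "'a::euclidean_space \<times> real \<Rightarrow> 'a \<times> real \<Rightarrow> real" where
  "lorentz p q = fst p \<bullet> fst q - snd p * snd q"

text \<open>The type \<open>'a hyp_space\<close> is hyperbolic space of dimension \<open>d = DIM('a)\<close>: the upper sheet of
  the two-sheeted hyperboloid in the Lorentzian space \<open>'a \<times> real\<close>. The theory of metric spaces
  (\<open>compact\<close>, \<open>interior\<close>, \<open>diameter\<close>, \<open>setdist\<close>) then refers to the hyperbolic metric.\<close>

typedef (overloaded) 'a hyp_space =
  "{p :: 'a::euclidean_space \<times> real. lorentz p p = -1 \<and> snd p > 0}"
  morphisms hvec Abs_hyp_space
proof
  show "(0, 1) \<in> {p :: 'a \<times> real. lorentz p p = -1 \<and> snd p > 0}"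
    by (simp add: lorentz_def)
qed

lemma lorentz_commute: "lorentz p q = lorentz q p"
  by (simp add: lorentz_def inner_commute mult.commute)

lemma lorentz_add_left: "lorentz (p + q) r = lorentz p r + lorentz q r"
  by (simp add: lorentz_def inner_add_left algebra_simps)

lemma lorentz_add_right: "lorentz r (p + q) = lorentz r p + lorentz r q"
  by (simp add: lorentz_def inner_add_right algebra_simps)

lemma lorentz_diff_left: "lorentz (p - q) r = lorentz p r - lorentz q r"
  by (simp add: lorentz_def inner_diff_left algebra_simps)

lemma lorentz_diff_right: "lorentz r (p - q) = lorentz r p - lorentz r q"
  by (simp add: lorentz_def inner_diff_right algebra_simps)

lemma lorentz_scaleR_left: "lorentz (c *\<^sub>R p) r = c * lorentz p r"
  by (simp add: lorentz_def algebra_simps)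

lemma lorentz_scaleR_right: "lorentz r (c *\<^sub>R p) = c * lorentz r p"
  by (simp add: lorentz_def algebra_simps)

lemmas lorentz_simps =
  lorentz_add_left lorentz_add_right
  lorentz_diff_left lorentz_diff_right lorentz_scaleR_left lorentz_scaleR_right

lemma hvec_lorentz_self [simp]: "lorentz (hvec x) (hvec x) = -1"
  using hvec[of x] by simp

lemma hvec_snd_pos: "snd (hvec x) > 0"
  using hvec[of x] by simp

lemma hvec_norm_less: "norm (fst (hvec x)) < snd (hvec x)"
proof -
  have "(norm (fst (hvec x)))\<^sup>2 = (snd (hvec x))\<^sup>2 - 1"
    using hvec_lorentz_self[of x]
    unfolding power2_norm_eq_inner by (simp add: lorentz_def power2_eq_square)
  then have "(norm (fst (hvec x)))\<^sup>2 < (snd (hvec x))\<^sup>2" by simp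
  then show ?thesis
    by (rule power_less_imp_less_base) (use hvec_snd_pos[of x] in simp)
qed

text \<open>The Lorentz form is positive definite on the orthogonal complement of a time-like vector.\<close>

lemma lorentz_perp_pos:
  assumes "lorentz u (hvec y) = 0"
  shows "lorentz u u \<ge> 0" and "lorentz u u = 0 \<Longrightarrow> u = 0"
proof -
  let ?t = "snd (hvec y)" and ?n = "norm (fst (hvec y))"
  have eq: "fst u \<bullet> fst (hvec y) = snd u * ?t"
    using assms by (simp add: lorentz_def)
  have "\<bar>snd u\<bar> * ?t = \<bar>fst u \<bullet> fst (hvec y)\<bar>"
    using hvec_snd_pos[of y] by (simp add: eq abs_mult)
  also have "\<dots> \<le> norm (fst u) * ?n" by (rule Cauchy_Schwarz_ineq2)
  finally have le: "\<bar>snd u\<bar> * ?t \<le> norm (fst u) * ?n" .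
  have strict: "\<bar>snd u\<bar> < norm (fst u)" if "fst u \<noteq> 0"
  proof -
    have "norm (fst u) * ?n < norm (fst u) * ?t"
      using that hvec_norm_less[of y] by simp
    with le have "\<bar>snd u\<bar> * ?t < norm (fst u) * ?t" by linarith
    then show ?thesis using hvec_snd_pos[of y] by simp
  qed
  have zero: "snd u = 0" if "fst u = 0"
    using eq that hvec_snd_pos[of y] by simp
  have form: "lorentz u u = (norm (fst u))\<^sup>2 - \<bar>snd u\<bar>\<^sup>2"
    by (simp add: lorentz_def power2_norm_eq_inner) (simp add: power2_eq_square)
  have pos: "lorentz u u > 0" if "fst u \<noteq> 0"
    using power_strict_mono[OF strict[OF that], of 2] form by simp
  show "lorentz u u \<ge> 0"
    using pos zero by (cases "fst u = 0") (auto simp: form)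
  show "u = 0" if "lorentz u u = 0"
    using pos zero that by (cases "fst u = 0") (auto simp: prod_eq_iff)
qed

lemma lorentz_perp_Cauchy_Schwarz:
  assumes u: "lorentz u (hvec y) = 0" and v: "lorentz v (hvec y) = 0"
  shows "(lorentz u v)\<^sup>2 \<le> lorentz u u * lorentz v v"
proof (cases "lorentz v v = 0")
  case True
  then have "v = 0" by (rule lorentz_perp_pos(2)[OF v])
  then show ?thesis by (simp add: lorentz_def)
next
  case False
  then have vpos: "lorentz v v > 0" using lorentz_perp_pos(1)[OF v] by linarith
  let ?w = "lorentz v v *\<^sub>R u - lorentz u v *\<^sub>R v"
  have "lorentz ?w (hvec y) = 0" using u v by (simp add: lorentz_simps)
  then have "0 \<le> lorentz ?w ?w" by (rule lorentz_perp_pos(1))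
  also have "lorentz ?w ?w = lorentz v v * (lorentz u u * lorentz v v - (lorentz u v)\<^sup>2)"
    by (simp add: lorentz_simps lorentz_commute[of v u] power2_eq_square algebra_simps)
  finally show ?thesis using vpos by (simp add: zero_le_mult_iff)
qed

lemma hvec_perp_part:
  fixes x y :: "'a::euclidean_space hyp_space"
  defines "u \<equiv> hvec x - (- lorentz (hvec x) (hvec y)) *\<^sub>R hvec y"
  shows "lorentz u (hvec y) = 0" and "lorentz u u = (lorentz (hvec x) (hvec y))\<^sup>2 - 1"
  by (simp_all add: u_def lorentz_simps lorentz_commute[of "hvec y" "hvec x"] power2_eq_square)

lemma hvec_lorentz_ge_1: "- lorentz (hvec x) (hvec y) \<ge> 1"
proof -
  have "norm (fst (hvec x)) * norm (fst (hvec y)) < snd (hvec x) * snd (hvec y)"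
    by (rule mult_strict_mono) (auto simp: hvec_norm_less hvec_snd_pos)
  then have pos: "- lorentz (hvec x) (hvec y) > 0"
    using norm_cauchy_schwarz[of "fst (hvec x)" "fst (hvec y)"]
    by (simp add: lorentz_def)
  have "0 \<le> (lorentz (hvec x) (hvec y))\<^sup>2 - 1"
    using lorentz_perp_pos(1)[OF hvec_perp_part(1)[of x y]] hvec_perp_part(2)[of x y] by simp
  then have "1\<^sup>2 \<le> (- lorentz (hvec x) (hvec y))\<^sup>2" by simp
  then show ?thesis by (rule power2_le_imp_le) (use pos in simp)
qed

lemma hvec_lorentz_eq_1: "- lorentz (hvec x) (hvec y) = 1 \<longleftrightarrow> x = y"
proof
  assume a: "- lorentz (hvec x) (hvec y) = 1"
  then have "lorentz (hvec x) (hvec y) = -1" by simp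
  then have "hvec x - (- lorentz (hvec x) (hvec y)) *\<^sub>R hvec y = 0"
    using lorentz_perp_pos(2)[OF hvec_perp_part(1)[of x y]] hvec_perp_part(2)[of x y] by simp
  then show "x = y" using a by (simp add: hvec_inject)
qed simp

lemma hvec_lorentz_triangle:
  "- lorentz (hvec x) (hvec z) \<le>
     cosh (arcosh (- lorentz (hvec x) (hvec y)) + arcosh (- lorentz (hvec y) (hvec z)))"
proof -
  define a b where "a = - lorentz (hvec x) (hvec y)" and "b = - lorentz (hvec z) (hvec y)"
  define u v where "u = hvec x - a *\<^sub>R hvec y" and "v = hvec z - b *\<^sub>R hvec y"
  have a: "a \<ge> 1" and b: "b \<ge> 1" by (simp_all only: a_def b_def hvec_lorentz_ge_1)
  have uv: "(lorentz u v)\<^sup>2 \<le> (a\<^sup>2 - 1) * (b\<^sup>2 - 1)"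
    using lorentz_perp_Cauchy_Schwarz[OF hvec_perp_part(1)[of x y] hvec_perp_part(1)[of z y]]
      hvec_perp_part(2)[of x y] hvec_perp_part(2)[of z y]
    by (simp add: u_def v_def a_def b_def)
  have "- lorentz u v \<le> sqrt ((a\<^sup>2 - 1) * (b\<^sup>2 - 1))"
    by (rule real_le_rsqrt) (use uv in simp)
  moreover have "lorentz u v = lorentz (hvec x) (hvec z) + a * b"
    by (simp add: u_def v_def lorentz_simps a_def b_def lorentz_commute[of "hvec y" "hvec z"])
  moreover have "cosh (arcosh a + arcosh b) = a * b + sqrt ((a\<^sup>2 - 1) * (b\<^sup>2 - 1))"
    using a b by (simp add: cosh_add sinh_arcosh_real real_sqrt_mult)
  ultimately have "- lorentz (hvec x) (hvec z) \<le> cosh (arcosh a + arcosh b)" by linarith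
  then show ?thesis by (simp add: a_def b_def lorentz_commute[of "hvec y" "hvec z"])
qed

instantiation hyp_space :: (euclidean_space) metric_space
begin

definition dist_hyp_space :: "'a hyp_space \<Rightarrow> 'a hyp_space \<Rightarrow> real" where
  "dist x y = arcosh (- lorentz (hvec x) (hvec y))"

definition uniformity_hyp_space_def:
  "(uniformity :: ('a hyp_space \<times> 'a hyp_space) filter) =
     (INF e\<in>{0<..}. principal {(x, y). dist x y < e})"

definition open_hyp_space_def:
  "open (U :: 'a hyp_space set) \<longleftrightarrow>
     (\<forall>x\<in>U. eventually (\<lambda>(x', y). x' = x \<longrightarrow> y \<in> U) uniformity)"

instance
proof
  fix x y z :: "'a hyp_space"
  show "dist x y = 0 \<longleftrightarrow> x = y"
    unfolding dist_hyp_space_def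
    using hvec_lorentz_ge_1[of x y] hvec_lorentz_eq_1[of x y] by simp
  have tri: "dist x z \<le> dist x y + dist y z" for x y z :: "'a hyp_space"
  proof -
    have "dist x z \<le> arcosh (cosh (dist x y + dist y z))"
      unfolding dist_hyp_space_def
      using hvec_lorentz_triangle[of x z y] hvec_lorentz_ge_1[of x z]
      by (metis arcosh_less_iff_real cosh_real_ge_1 not_less)
    also have "\<dots> = dist x y + dist y z"
      unfolding dist_hyp_space_def
      by (intro arcosh_cosh_real add_nonneg_nonneg arcosh_nonneg_real hvec_lorentz_ge_1)
    finally show ?thesis .
  qed
  have "dist y z = dist z y"
    by (simp add: dist_hyp_space_def lorentz_commute)
  then show "dist x y \<le> dist x z + dist y z"
    using tri[of x y z] by simp
qed (simp_all add: uniformity_hyp_space_def open_hyp_space_def)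

end


section \<open>Hyperplanes and convex bodies\<close>

text \<open>Totally geodesic subspaces of dimension \<open>m\<close> are the non-empty sections of the hyperboloid
  by linear subspaces of dimension \<open>m + 1\<close>; below, \<open>m + 1 = (d - 1) + 1 = DIM('a)\<close>.\<close>

definition hyperplane :: "'a::euclidean_space hyp_space set \<Rightarrow> bool" where
  "hyperplane H \<longleftrightarrow>
     H \<noteq> {} \<and> (\<exists>V. subspace V \<and> dim V = DIM('a) \<and> H = {x. hvec x \<in> V})"

text \<open>The ideal points of a hyperplane are represented by the light-like vectors of the linear
  subspace that cuts it out. Hyperplanes are ultraparallel if they have no common point, not even
  an ideal one (so limiting parallel hyperplanes are not ultraparallel).\<close>

definition ideal_points :: "'a::euclidean_space hyp_space set \<Rightarrow> ('a \<times> real) set" where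
  "ideal_points H = {v \<in> span (hvec ` H). v \<noteq> 0 \<and> lorentz v v = 0}"

definition ultraparallel ::
    "'a::euclidean_space hyp_space set \<Rightarrow> 'a hyp_space set \<Rightarrow> bool" where
  "ultraparallel H G \<longleftrightarrow> H \<inter> G = {} \<and> ideal_points H \<inter> ideal_points G = {}"

text \<open>When \<open>H\<close> is a hyperplane of the form \<open>{x. lorentz n (hvec x) = 0}\<close>, the sets
  \<open>{x. lorentz n (hvec x) \<le> 0}\<close> and \<open>{x. lorentz (- n) (hvec x) \<le> 0}\<close> are the two closed half-spaces
  bounded by \<open>H\<close>.\<close>

definition supports ::
    "'a::euclidean_space hyp_space set \<Rightarrow> 'a hyp_space set \<Rightarrow> bool" (infix "supports" 50) where
  "H supports C \<longleftrightarrow>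
     hyperplane H \<and> H \<inter> C \<noteq> {} \<and>
     (\<exists>n. H = {x. lorentz n (hvec x) = 0} \<and> C \<subseteq> {x. lorentz n (hvec x) \<le> 0})"

text \<open>The geodesic segment with endpoints \<open>x\<close> and \<open>y\<close>.\<close>

definition geodesic_segment ::
    "'a::euclidean_space hyp_space \<Rightarrow> 'a hyp_space \<Rightarrow> 'a hyp_space set" where
  "geodesic_segment x y = {z. dist x z + dist z y = dist x y}"

definition geodesically_convex :: "'a::euclidean_space hyp_space set \<Rightarrow> bool" where
  "geodesically_convex C \<longleftrightarrow> (\<forall>x\<in>C. \<forall>y\<in>C. geodesic_segment x y \<subseteq> C)"

definition convex_body :: "'a::euclidean_space hyp_space set \<Rightarrow> bool" where
  "convex_body C \<longleftrightarrow> compact C \<and> geodesically_convex C \<and> interior C \<noteq> {}"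


section \<open>Completeness and width\<close>

text \<open>Completeness in the sense of diameters, unrelated to the library's metric \<open>complete\<close>. The
  boundedness requirement makes \<open>diameter\<close> meaningful.\<close>

definition diameter_complete :: "'a::euclidean_space hyp_space set \<Rightarrow> bool" where
  "diameter_complete C \<longleftrightarrow>
     bounded C \<and> (\<forall>x. x \<notin> C \<longrightarrow> diameter (insert x C) > diameter C)"

definition complete_body :: "'a::euclidean_space hyp_space set \<Rightarrow> bool" where
  "complete_body C \<longleftrightarrow> convex_body C \<and> diameter_complete C"

text \<open>All farthest hyperplanes have the same distance from \<open>H\<close>, so the choice made by
  \<open>ARG_MAX\<close> is immaterial.\<close>

definition width :: "'a::euclidean_space hyp_space set \<Rightarrow> 'a hyp_space set \<Rightarrow> real" where
  "width H C = setdist H (ARG_MAX (setdist H) G. G supports C \<and> ultraparallel H G)"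

definition constant_width :: "real \<Rightarrow> 'a::euclidean_space hyp_space set \<Rightarrow> bool" where
  "constant_width \<delta> W \<longleftrightarrow> convex_body W \<and> (\<forall>H. H supports W \<longrightarrow> width H W = \<delta>)"

end

theory Submission
  imports Defs
begin

text \<open>
  Let \<open>H\<close> support \<open>C\<close> at \<open>p\<close> with unit outer normal \<open>n\<close>, and let \<open>q\<close> be the point at distance \<open>\<delta>\<close>
  from \<open>p\<close> along the inner normal. The point is that \<open>q \<in> C\<close>. Otherwise, by completeness, some
  \<open>z \<in> C\<close> has \<open>dist z q > \<delta>\<close>. Moving \<open>p\<close> slightly in the direction of \<open>z\<close> plus a suitable multiple
  of \<open>n\<close> then keeps it within \<open>\<delta>\<close> of all points of \<open>C\<close>, hence in \<open>C\<close>, but brings it to the wrong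
  side of \<open>H\<close>. Since \<open>C\<close> lies in the ball of radius \<open>\<delta>\<close> around \<open>p\<close>, the hyperplane \<open>G\<close> through \<open>q\<close>
  perpendicular to the segment \<open>pq\<close> supports \<open>C\<close>, and \<open>pq\<close> is the common perpendicular of \<open>H\<close>
  and \<open>G\<close>, so they have distance \<open>\<delta>\<close>. No supporting hyperplane is farther from \<open>H\<close>, because each
  one meets \<open>C\<close>.
\<close>

section \<open>Distances, points and geodesics in the hyperboloid model\<close>

lemma cosh_dist_hyp: "cosh (dist x y) = - lorentz (hvec x) (hvec y)"
  using hvec_lorentz_ge_1[of x y] by (simp add: dist_hyp_space_def)

lemma dist_hyp_le_iff:
  assumes "0 \<le> r"
  shows "dist x y \<le> r \<longleftrightarrow> - lorentz (hvec x) (hvec y) \<le> cosh r"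
  using assms by (simp add: cosh_real_nonneg_le_iff flip: cosh_dist_hyp)

text \<open>By Cauchy-Schwarz on the spatial parts, a time-like vector with nonpositive last
  coordinate would have a nonnegative product with \<open>hvec p\<close>. So \<open>future\<close>
  selects the upper sheet and only rescaling remains.\<close>

lemma hvec_normalize:
  assumes neg: "lorentz v v < 0" and future: "lorentz v (hvec p) < 0"
  obtains x where "hvec x = (1 / sqrt (- lorentz v v)) *\<^sub>R v"
proof -
  have "(norm (fst v))\<^sup>2 < \<bar>snd v\<bar>\<^sup>2"
    using neg by (simp add: lorentz_def power2_norm_eq_inner) (simp add: power2_eq_square)
  then have less: "norm (fst v) < \<bar>snd v\<bar>"
    by (rule power_less_imp_less_base) simp
  have pos: "snd v > 0"
  proof (rule ccontr)
    assume "\<not> snd v > 0"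
    then have "norm (fst v) * norm (fst (hvec p)) \<le> - snd v * snd (hvec p)"
      using less hvec_norm_less[of p] by (intro mult_mono) auto
    moreover have "- (norm (fst v) * norm (fst (hvec p))) \<le> fst v \<bullet> fst (hvec p)"
      using Cauchy_Schwarz_ineq2[of "fst v" "fst (hvec p)"] by linarith
    ultimately show False using future by (simp add: lorentz_def)
  qed
  let ?u = "(1 / sqrt (- lorentz v v)) *\<^sub>R v"
  have "(1 / sqrt (- lorentz v v)) * (1 / sqrt (- lorentz v v)) = 1 / (- lorentz v v)"
    using neg by (simp del: real_sqrt_minus)
  then have "lorentz ?u ?u = -1"
    using neg unfolding lorentz_scaleR_left lorentz_scaleR_right mult.assoc[symmetric] by simp
  moreover have "snd ?u > 0" using pos neg by simp
  ultimately have "hvec (Abs_hyp_space ?u) = ?u" by (intro Abs_hyp_space_inverse) simp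
  then show thesis by (rule that)
qed

text \<open>The formula is the unit-speed geodesic through \<open>p\<close> with velocity
  \<open>n\<close>, at time \<open>s\<close>.\<close>

lemma hvec_geodesic:
  assumes "lorentz n (hvec p) = 0" "lorentz n n = 1"
  obtains x where "hvec x = cosh s *\<^sub>R hvec p + sinh s *\<^sub>R n"
proof -
  let ?v = "cosh s *\<^sub>R hvec p + sinh s *\<^sub>R n"
  have "lorentz ?v ?v = - (cosh s)\<^sup>2 + (sinh s)\<^sup>2"
    using assms lorentz_commute[of n "hvec p"] by (simp add: lorentz_simps power2_eq_square)
  then have v: "lorentz ?v ?v = -1"
    using cosh_square_eq[of s] by simp
  have "lorentz ?v (hvec p) < 0"
    using assms cosh_real_pos[of s] by (simp add: lorentz_simps)
  then show thesis
    using hvec_normalize[of ?v p] v that by auto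
qed

section \<open>Hyperplanes and their normals\<close>

lemma lorentz_hvec_nondegenerate:
  assumes "\<And>x. lorentz n (hvec x) = 0"
  shows "n = 0"
proof -
  have point: "\<exists>x. hvec x = (a, sqrt (1 + (norm a)\<^sup>2))" for a :: 'a
  proof -
    have "0 \<le> 1 + a \<bullet> a" "0 < 1 + a \<bullet> a"
      using inner_ge_zero[of a] by linarith+
    then have "hvec (Abs_hyp_space (a, sqrt (1 + (norm a)\<^sup>2))) = (a, sqrt (1 + (norm a)\<^sup>2))"
      by (intro Abs_hyp_space_inverse) (simp add: lorentz_def power2_norm_eq_inner)
    then show ?thesis by blast
  qed
  \<comment> \<open>The apex forces \<open>snd n = 0\<close>; the point above \<open>fst n\<close>
    then gives \<open>fst n \<bullet> fst n = 0\<close>.\<close>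
  obtain x where "hvec x = (0::'a, sqrt (1 + (norm (0::'a))\<^sup>2))" using point[of 0] by blast
  then have s: "snd n = 0" using assms[of x] by (simp add: lorentz_def)
  obtain y where "hvec y = (fst n, sqrt (1 + (norm (fst n))\<^sup>2))" using point[of "fst n"] by blast
  then have "fst n = 0" using assms[of y] s by (simp add: lorentz_def)
  with s show ?thesis by (simp add: prod_eq_iff)
qed

lemma dim_lorentz_orthogonal:
  fixes m :: "'a::euclidean_space \<times> real"
  assumes "m \<noteq> 0"
  shows "dim {v. lorentz m v = 0} = DIM('a)"
proof -
  have "{v. lorentz m v = 0} = {v. (fst m, - snd m) \<bullet> v = 0}"
    by (auto simp: lorentz_def inner_prod_def)
  moreover have "(fst m, - snd m) \<noteq> 0" using assms by (auto simp: prod_eq_iff)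
  ultimately show ?thesis using dim_hyperplane[of "(fst m, - snd m)"] by simp
qed

lemma subspace_lorentz_orthogonal: "subspace {v. lorentz m v = 0}"
  by (auto simp: subspace_def lorentz_simps) (simp add: lorentz_def)

lemma hyperplane_lorentz_orthogonal:
  assumes "m \<noteq> 0" "lorentz m (hvec q) = 0"
  shows "hyperplane {x. lorentz m (hvec x) = 0}"
  unfolding hyperplane_def
  using assms subspace_lorentz_orthogonal[of m] dim_lorentz_orthogonal[of m] by blast

text \<open>For \<open>n = 0\<close> the whole hyperboloid would lie in a proper subspace. A
  Euclidean normal of that subspace, with its last coordinate negated, would be Lorentz-orthogonal
  to every point, against nondegeneracy.\<close>

lemma hyperplane_normal_nonzero:
  assumes "hyperplane {x::'a::euclidean_space hyp_space. lorentz n (hvec x) = 0}"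
  shows "n \<noteq> 0"
proof
  assume "n = 0"
  then have "{x::'a hyp_space. lorentz n (hvec x) = 0} = UNIV"
    by (simp add: lorentz_def)
  with assms obtain V :: "('a \<times> real) set"
    where V: "subspace V" "dim V = DIM('a)" "\<And>x. hvec x \<in> V"
    unfolding hyperplane_def by auto
  have "span V \<subset> span UNIV"
  proof -
    have "dim V \<noteq> dim (UNIV :: ('a \<times> real) set)" using V(2) by simp
    then have "V \<noteq> UNIV" by metis
    then show ?thesis using V(1) by (simp add: span_eq_iff[THEN iffD2] psubset_eq)
  qed
  then obtain a where a: "a \<noteq> 0" "\<And>y. y \<in> span V \<Longrightarrow> orthogonal a y"
    using orthogonal_to_subspace_exists_gen[of V UNIV] by blast
  have "lorentz (fst a, - snd a) (hvec x) = 0" for x :: "'a hyp_space"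
    using a(2)[OF span_base[OF V(3)[of x]]]
    by (simp add: lorentz_def orthogonal_def inner_prod_def)
  then have "(fst a, - snd a) = 0" by (rule lorentz_hvec_nondegenerate)
  with a(1) show False by (simp add: prod_eq_iff)
qed

text \<open>A normal is orthogonal to the time-like vector of a contact point, hence space-like, and
  can be scaled to unit length.\<close>

lemma supports_unit_normal:
  assumes "H supports C"
  obtains n p where "H = {x. lorentz n (hvec x) = 0}" "lorentz n n = 1"
    "p \<in> C" "p \<in> H" "\<And>x. x \<in> C \<Longrightarrow> lorentz n (hvec x) \<le> 0"
proof -
  obtain n p where n: "H = {x. lorentz n (hvec x) = 0}" "C \<subseteq> {x. lorentz n (hvec x) \<le> 0}"
    and p: "p \<in> C" "p \<in> H" and H: "hyperplane H"
    using assms unfolding supports_def by blast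
  have "n \<noteq> 0" using hyperplane_normal_nonzero H n(1) by blast
  moreover have "lorentz n (hvec p) = 0" using p n(1) by simp
  ultimately have pos: "lorentz n n > 0"
    using lorentz_perp_pos[of n p] by fastforce
  let ?c = "1 / sqrt (lorentz n n)"
  have c: "?c > 0" using pos by simp
  have "?c * ?c = 1 / lorentz n n" using pos by simp
  then have "lorentz (?c *\<^sub>R n) (?c *\<^sub>R n) = 1"
    using pos unfolding lorentz_scaleR_left lorentz_scaleR_right mult.assoc[symmetric] by simp
  moreover have "H = {x. lorentz (?c *\<^sub>R n) (hvec x) = 0}"
    using c by (simp add: n(1) lorentz_simps)
  moreover have "lorentz (?c *\<^sub>R n) (hvec x) \<le> 0" if "x \<in> C" for x
    unfolding lorentz_scaleR_left
    by (rule mult_nonneg_nonpos) (use c n(2) that in auto)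
  ultimately show thesis using that p by blast
qed

section \<open>Complete sets and the point opposite a contact point\<close>

lemma diameter_complete_memI:
  assumes C: "diameter_complete C" and x: "\<And>c. c \<in> C \<Longrightarrow> dist x c \<le> diameter C"
  shows "x \<in> C"
proof (rule ccontr)
  assume nx: "x \<notin> C"
  have b: "bounded C" using C by (simp add: diameter_complete_def)
  have "0 \<le> diameter C" using b by (rule diameter_ge_0)
  then have le: "dist u v \<le> diameter C" if "u \<in> insert x C" "v \<in> insert x C" for u v
    using that x diameter_bounded_bound[OF b, of u v] by (auto simp: dist_commute)
  have "diameter (insert x C) \<le> diameter C"
    unfolding diameter_def[of "insert x C"]
    by (simp del: insert_Times_insert) (rule cSUP_least, use le in auto)
  with C nx show False by (auto simp: diameter_complete_def not_less[symmetric])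
qed

text \<open>Only the component of \<open>hvec c\<close> tangent at \<open>p\<close> contributes, and
  its length is \<open>sinh (dist p c)\<close>; Cauchy-Schwarz does the rest.\<close>

lemma lorentz_tangent_bound:
  assumes n: "lorentz n (hvec p) = 0" "lorentz n n = 1"
  shows "\<bar>lorentz n (hvec c)\<bar> \<le> sinh (dist p c)"
proof -
  let ?u = "hvec c - (- lorentz (hvec c) (hvec p)) *\<^sub>R hvec p"
  have "(lorentz n ?u)\<^sup>2 \<le> lorentz n n * lorentz ?u ?u"
    using n(1) hvec_perp_part(1) by (rule lorentz_perp_Cauchy_Schwarz)
  also have "\<dots> = (cosh (dist p c))\<^sup>2 - 1"
    using n(2) by (simp only: hvec_perp_part(2) cosh_dist_hyp lorentz_commute[of "hvec p"]) simp
  also have "\<dots> = (sinh (dist p c))\<^sup>2" using cosh_square_eq[of "dist p c"] by simp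
  finally have "(lorentz n (hvec c))\<^sup>2 \<le> (sinh (dist p c))\<^sup>2"
    using n(1) by (simp add: lorentz_simps)
  then have "\<bar>lorentz n (hvec c)\<bar> \<le> \<bar>sinh (dist p c)\<bar>" by (simp only: abs_le_square_iff)
  then show ?thesis by simp
qed

lemma diameter_complete_inner_normal_point:
  assumes C: "diameter_complete C" and p: "p \<in> C"
    and \<delta>: "diameter C > 0"
    and n: "lorentz n (hvec p) = 0" "lorentz n n = 1"
    and le0: "\<And>x. x \<in> C \<Longrightarrow> lorentz n (hvec x) \<le> 0"
    and q: "hvec q = cosh (diameter C) *\<^sub>R hvec p - sinh (diameter C) *\<^sub>R n"
  shows "q \<in> C"
proof (rule ccontr)
  define D S where "D = cosh (diameter C)" and "S = sinh (diameter C)"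
  have D1: "D \<ge> 1" unfolding D_def by (rule cosh_real_ge_1)
  have S0: "S > 0" using \<delta> by (simp add: S_def)
  have dist_le: "dist x y \<le> diameter C" if "x \<in> C" "y \<in> C" for x y
    using C that by (auto simp: diameter_complete_def intro: diameter_bounded_bound)
  have le_D: "- lorentz (hvec x) (hvec y) \<le> D" if "x \<in> C" "y \<in> C" for x y
    using dist_hyp_le_iff[of "diameter C" x y] dist_le[OF that] \<delta> by (simp add: D_def)
  have memI: "x \<in> C" if "\<And>c. c \<in> C \<Longrightarrow> - lorentz (hvec x) (hvec c) \<le> D" for x
    using dist_hyp_le_iff[of "diameter C" x] \<delta> that
    by (intro diameter_complete_memI[OF C]) (simp add: D_def)
  assume "q \<notin> C"
  then obtain z where z: "z \<in> C" and far: "- lorentz (hvec q) (hvec z) > D"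
    using memI[of q] by (meson not_less)
  define A where "A = - lorentz (hvec z) (hvec p)"
  define b where "b = - lorentz n (hvec z)"
  have far': "D * A - S * b > D"
    using far by (simp add: q lorentz_simps A_def b_def lorentz_commute[of "hvec p"]
        flip: D_def S_def)
  have b0: "b \<ge> 0" using le0[OF z] by (simp add: b_def)
  have "b < (A - 1) * D / S" using far' S0 by (simp add: field_simps)
  \<comment> \<open>The interval is nonempty because \<open>z\<close> is too far from
    \<open>q\<close>. The lower bound on \<open>t\<close> makes \<open>w\<close> point strictly
    outward, the upper one makes the first-order gain \<open>\<kappa>\<close> positive.\<close>
  then obtain t where t: "b < t" "t < (A - 1) * D / S" using dense by blast
  define \<kappa> where "\<kappa> = (A - 1) * D - t * S"
  have \<kappa>: "\<kappa> > 0" using t(2) S0 by (simp add: \<kappa>_def field_simps)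
  have A1: "A \<ge> 1" unfolding A_def by (rule hvec_lorentz_ge_1)
  \<comment> \<open>The part of \<open>hvec z\<close> tangent at \<open>p\<close>, tilted outward by
    \<open>t *\<^sub>R n\<close>; \<open>W\<close> is its squared length.\<close>
  define w where "w = hvec z - A *\<^sub>R hvec p + t *\<^sub>R n"
  define W where "W = lorentz w w"
  have wp: "lorentz w (hvec p) = 0"
    using n by (simp add: w_def lorentz_simps A_def)
  have W0: "W \<ge> 0" unfolding W_def using wp by (rule lorentz_perp_pos(1))
  have wn: "lorentz n w > 0"
    using t(1) n by (simp add: w_def lorentz_simps b_def)
  \<comment> \<open>In turn, the bounds make the coefficient \<open>1 - \<epsilon> * A\<close>
    nonnegative, keep \<open>v\<close> time-like (with \<open>\<epsilon> \<le> 1\<close>), and let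
    the gain \<open>\<epsilon> * \<kappa>\<close> absorb the second-order loss
    \<open>\<epsilon> * (\<epsilon> * (W * D))\<close> from normalizing \<open>v\<close>.\<close>
  define \<epsilon> where "\<epsilon> = min (1 / A) (min (1 / (W + 1)) (\<kappa> / ((W + 1) * D)))"
  have \<epsilon>0: "\<epsilon> > 0" using A1 W0 \<kappa> D1 by (simp add: \<epsilon>_def)
  have "\<epsilon> \<le> 1 / A" "\<epsilon> \<le> 1 / (W + 1)" "\<epsilon> \<le> \<kappa> / ((W + 1) * D)"
    unfolding \<epsilon>_def by linarith+
  then have \<epsilon>A: "\<epsilon> * A \<le> 1" and \<epsilon>W: "\<epsilon> * (W + 1) \<le> 1" and \<epsilon>\<kappa>: "\<epsilon> * ((W + 1) * D) \<le> \<kappa>"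
    using A1 W0 D1 by (simp_all add: pos_le_divide_eq)
  have "\<epsilon> \<le> \<epsilon> * A" using A1 \<epsilon>0 by simp
  then have "\<epsilon> \<le> 1" using \<epsilon>A by linarith
  have \<epsilon>W1: "\<epsilon> * W < 1" using \<epsilon>W \<epsilon>0 by (simp add: algebra_simps)
  have "\<epsilon> * (\<epsilon> * W) \<le> 1 * (\<epsilon> * W)"
    using \<open>\<epsilon> \<le> 1\<close> \<epsilon>0 W0 by (intro mult_right_mono) auto
  then have small: "\<epsilon> * (\<epsilon> * W) < 1" using \<epsilon>W1 by linarith
  define v where "v = hvec p + \<epsilon> *\<^sub>R w"
  have vv: "lorentz v v = - (1 - \<epsilon> * (\<epsilon> * W))"
    using wp lorentz_commute[of "hvec p" w] by (simp add: v_def lorentz_simps W_def)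
  have vp: "lorentz v (hvec p) < 0"
    using wp by (simp add: v_def lorentz_simps)
  define N where "N = sqrt (- lorentz v v)"
  have N0: "N > 0" using vv small by (simp add: N_def)
  obtain x where x: "hvec x = (1 / N) *\<^sub>R v"
    using hvec_normalize[OF _ vp] vv small unfolding N_def by auto
  have "0 \<le> 1 - \<epsilon> * (\<epsilon> * W)" "1 - \<epsilon> * (\<epsilon> * W) \<le> 1"
    using small \<epsilon>0 W0 by auto
  then have "(1 - \<epsilon> * (\<epsilon> * W))\<^sup>2 \<le> 1 - \<epsilon> * (\<epsilon> * W)"
    by (simp add: power2_eq_square mult_left_le)
  \<comment> \<open>On \<open>[0, 1]\<close> the square root is at least its argument.\<close>
  then have N: "N \<ge> 1 - \<epsilon> * (\<epsilon> * W)"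
    unfolding N_def vv by (intro real_le_rsqrt) simp
  have "x \<in> C"
  proof (rule memI)
    fix c assume c: "c \<in> C"
    have "- lorentz v (hvec c) = (1 - \<epsilon> * A) * (- lorentz (hvec p) (hvec c))
        + \<epsilon> * (- lorentz (hvec z) (hvec c)) + \<epsilon> * t * (- lorentz n (hvec c))"
      by (simp add: v_def w_def lorentz_simps algebra_simps)
    \<comment> \<open>The first two products are at most \<open>D\<close> since they pair points of
      \<open>C\<close>; the third is at most \<open>S\<close> by the tangent bound.\<close>
    also have "\<dots> \<le> (1 - \<epsilon> * A) * D + \<epsilon> * D + \<epsilon> * t * S"
    proof (intro add_mono mult_left_mono le_D p z c)
      have "sinh (dist p c) \<le> S" using dist_le[OF p c] by (simp add: S_def)
      then show "- lorentz n (hvec c) \<le> S" using lorentz_tangent_bound[OF n, of c] by linarith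
    qed (use \<epsilon>0 \<epsilon>A t b0 in auto)
    also have "\<dots> = D - \<epsilon> * \<kappa>" by (simp add: \<kappa>_def algebra_simps)
    also have "\<dots> \<le> D - \<epsilon> * (\<epsilon> * (W * D))"
    proof -
      have "\<epsilon> * (W * D) \<le> \<epsilon> * ((W + 1) * D)"
        using \<epsilon>0 D1 by (simp add: algebra_simps)
      with \<epsilon>\<kappa> have "\<epsilon> * (W * D) \<le> \<kappa>" by linarith
      then show ?thesis using \<epsilon>0 by simp
    qed
    also have "\<dots> = (1 - \<epsilon> * (\<epsilon> * W)) * D" by (simp add: algebra_simps)
    also have "\<dots> \<le> N * D" using N D1 by simp
    finally show "- lorentz (hvec x) (hvec c) \<le> D"
      using N0 by (simp add: x lorentz_simps field_simps)
  qed
  then have "lorentz n (hvec x) \<le> 0" by (rule le0)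
  \<comment> \<open>The outward tilt of \<open>w\<close> puts \<open>x\<close> strictly beyond the
    hyperplane.\<close>
  moreover have "lorentz n (hvec x) = \<epsilon> * lorentz n w / N"
    using n(1) by (simp add: x v_def lorentz_simps)
  ultimately show False using \<epsilon>0 wn N0 by (simp add: divide_le_0_iff mult_le_0_iff)
qed

text \<open>Otherwise \<open>C\<close> is just \<open>p\<close>, yet a ball around an interior point
  also contains a nearby point of the geodesic in direction \<open>n\<close>.\<close>

lemma convex_body_diameter_pos:
  assumes "convex_body C"
    and p: "p \<in> C" and n: "lorentz n (hvec p) = 0" "lorentz n n = 1"
  shows "diameter C > 0"
proof (rule ccontr)
  assume "\<not> diameter C > 0"
  have b: "bounded C" and i: "interior C \<noteq> {}"
    using assms(1) compact_imp_bounded by (auto simp: convex_body_def)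
  have single: "c = p" if "c \<in> C" for c
    using diameter_bounded_bound[OF b that p] \<open>\<not> diameter C > 0\<close> zero_le_dist[of c p]
    by (metis dist_eq_0_iff antisym not_less order_trans)
  obtain o' where "o' \<in> interior C" using i by blast
  then have "p \<in> interior C" using single interior_subset by blast
  then obtain e where e: "e > 0" "ball p e \<subseteq> C" by (meson mem_interior)
  obtain x where x: "hvec x = cosh (e / 2) *\<^sub>R hvec p + sinh (e / 2) *\<^sub>R n"
    using hvec_geodesic[OF n] by blast
  have "cosh (dist x p) = cosh (e / 2)"
    using n by (simp add: cosh_dist_hyp x lorentz_simps)
  then have "dist x p = e / 2"
    using e(1) by (metis arcosh_cosh_real half_gt_zero less_imp_le zero_le_dist)
  then have "x \<in> C" "x \<noteq> p" using e by (auto simp: dist_commute)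
  then show False using single by blast
qed

section \<open>Two hyperplanes with a common perpendicular\<close>

text \<open>\<open>n\<close> and \<open>m\<close> are the unit tangent vectors at \<open>p\<close> and \<open>q\<close> of the geodesic through these points.\<close>

locale common_perpendicular =
  fixes p q :: "'a::euclidean_space hyp_space" and n m :: "'a \<times> real" and r :: real
  assumes r: "r > 0"
    and n: "lorentz n (hvec p) = 0" "lorentz n n = 1"
    and q: "hvec q = cosh r *\<^sub>R hvec p - sinh r *\<^sub>R n"
    and m: "m = sinh r *\<^sub>R hvec p - cosh r *\<^sub>R n"
begin

lemma sinh_r: "sinh r > 0" and cosh_r: "cosh r \<ge> 1"
  using r by (simp_all add: cosh_real_ge_1)

lemma cosh_square_r: "cosh r * cosh r = sinh r * sinh r + 1"
  using cosh_square_eq[of r] by (simp add: power2_eq_square)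

lemma p_n: "lorentz (hvec p) n = 0"
  using n(1) by (simp add: lorentz_commute)

lemma m_q: "lorentz m (hvec q) = 0" and m_m: "lorentz m m = 1"
  using n p_n cosh_square_r by (simp_all add: m q lorentz_simps)

text \<open>A vector orthogonal to \<open>n\<close> and \<open>m\<close> is orthogonal to
  \<open>hvec p\<close>, a combination of the two. The form is positive definite there, which
  excludes common points and common light-like vectors.\<close>

lemma hyperplanes_ultraparallel:
  "ultraparallel {x. lorentz n (hvec x) = 0} {x. lorentz m (hvec x) = 0}"
proof -
  have perp_p: "lorentz v (hvec p) = 0" if "lorentz n v = 0" "lorentz m v = 0" for v
    using that sinh_r by (simp add: m lorentz_simps lorentz_commute[of v])
  have ideal: "lorentz k v = 0" if "v \<in> span (hvec ` {x. lorentz k (hvec x) = 0})" for k v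
  proof -
    have "hvec ` {x. lorentz k (hvec x) = 0} \<subseteq> {v. lorentz k v = 0}" by blast
    from span_minimal[OF this subspace_lorentz_orthogonal] that show ?thesis by blast
  qed
  have "lorentz (hvec x) (hvec p) \<noteq> 0" for x
    using hvec_lorentz_ge_1[of x p] by auto
  then show ?thesis
    using perp_p lorentz_perp_pos(2) ideal unfolding ultraparallel_def ideal_points_def by blast
qed

text \<open>Removing the \<open>p\<close> and \<open>q\<close> components leaves \<open>u\<close>
  and \<open>v\<close>, both orthogonal to the plane of the geodesic \<open>pq\<close>.
  Cauchy-Schwarz gives \<open>lorentz u v \<le> a * b - 1\<close>, so \<open>cosh (dist x y)\<close>
  is at least \<open>a * b * (cosh r - 1) + 1\<close>, which is at least
  \<open>cosh r\<close>.\<close>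

lemma dist_hyperplanes_ge:
  assumes x: "lorentz n (hvec x) = 0" and y: "lorentz m (hvec y) = 0"
  shows "r \<le> dist x y"
proof -
  define a b where "a = - lorentz (hvec x) (hvec p)" and "b = - lorentz (hvec y) (hvec q)"
  define u v where "u = hvec x - a *\<^sub>R hvec p" and "v = hvec y - b *\<^sub>R hvec q"
  have a: "a \<ge> 1" and b: "b \<ge> 1" by (simp_all only: a_def b_def hvec_lorentz_ge_1)
  have up: "lorentz u (hvec p) = 0" and uu: "lorentz u u = a\<^sup>2 - 1"
    using hvec_perp_part[of x p] by (simp_all add: u_def a_def)
  have vq: "lorentz v (hvec q) = 0" and vv: "lorentz v v = b\<^sup>2 - 1"
    using hvec_perp_part[of y q] by (simp_all add: v_def b_def)
  have un: "lorentz u n = 0"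
    using x p_n by (simp add: u_def lorentz_simps lorentz_commute[of _ n] n)
  have vm: "lorentz v m = 0"
    using y m_q by (simp add: v_def lorentz_simps lorentz_commute[of _ m])
  \<comment> \<open>Travelling back from \<open>q\<close> along the same geodesic.\<close>
  have "hvec p = cosh r *\<^sub>R hvec q - sinh r *\<^sub>R m"
  proof -
    have "cosh r *\<^sub>R hvec q - sinh r *\<^sub>R m = (cosh r * cosh r - sinh r * sinh r) *\<^sub>R hvec p"
      by (simp add: q m algebra_simps)
    then show ?thesis using cosh_square_r by simp
  qed
  then have vp: "lorentz v (hvec p) = 0" using vq vm by (simp add: lorentz_simps)
  have uq: "lorentz u (hvec q) = 0" using up un by (simp add: q lorentz_simps)
  have "(lorentz u v)\<^sup>2 \<le> (a\<^sup>2 - 1) * (b\<^sup>2 - 1)"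
    using lorentz_perp_Cauchy_Schwarz[OF up vp] uu vv by simp
  also have "\<dots> = (a * b - 1)\<^sup>2 - (a - b)\<^sup>2" by (simp add: power2_eq_square algebra_simps)
  also have "\<dots> \<le> (a * b - 1)\<^sup>2" by simp
  finally have "\<bar>lorentz u v\<bar> \<le> \<bar>a * b - 1\<bar>" by (simp add: abs_le_square_iff)
  moreover have ab: "a * b \<ge> 1" using mult_mono[OF a b] a by simp
  ultimately have uv: "lorentz u v \<le> a * b - 1" by linarith
  have "lorentz (hvec x) (hvec y) = lorentz (u + a *\<^sub>R hvec p) (v + b *\<^sub>R hvec q)"
    by (simp add: u_def v_def)
  also have "\<dots> = lorentz u v + a * b * lorentz (hvec p) (hvec q)"
    using uq vp by (simp add: lorentz_add_left lorentz_add_right lorentz_scaleR_left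
        lorentz_scaleR_right lorentz_commute[of "hvec p" v])
  also have "lorentz (hvec p) (hvec q) = - cosh r" using p_n by (simp add: q lorentz_simps)
  finally have "- lorentz (hvec x) (hvec y) \<ge> a * b * (cosh r - 1) + 1"
    using uv by (simp add: algebra_simps)
  moreover have "a * b * (cosh r - 1) \<ge> 1 * (cosh r - 1)"
    using ab cosh_r by (intro mult_right_mono) auto
  ultimately have "cosh r \<le> cosh (dist x y)" by (simp add: cosh_dist_hyp)
  then show ?thesis using r by (simp add: cosh_real_nonneg_le_iff)
qed

lemma dist_p_q: "dist p q = r"
proof -
  have "cosh (dist p q) = cosh r" using p_n by (simp add: cosh_dist_hyp q lorentz_simps)
  then show ?thesis using r by (metis arcosh_cosh_real less_imp_le zero_le_dist)
qed

lemma setdist_hyperplanes: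
  "setdist {x. lorentz n (hvec x) = 0} {x. lorentz m (hvec x) = 0} = r"
proof (rule antisym)
  show "setdist {x. lorentz n (hvec x) = 0} {x. lorentz m (hvec x) = 0} \<le> r"
    using setdist_le_dist[of p "{x. lorentz n (hvec x) = 0}" q] n m_q dist_p_q by simp
  show "r \<le> setdist {x. lorentz n (hvec x) = 0} {x. lorentz m (hvec x) = 0}"
    using n(1) m_q dist_hyperplanes_ge by (intro le_setdistI) auto
qed

text \<open>The vector \<open>sinh r *\<^sub>R m\<close> equals
  \<open>cosh r *\<^sub>R hvec q - hvec p\<close>; products of points with \<open>hvec q\<close> are
  at most \<open>-1\<close>, and with \<open>hvec p\<close> at least \<open>- cosh r\<close> in the
  ball.\<close>

lemma cball_half_space:
  assumes "dist p x \<le> r"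
  shows "lorentz m (hvec x) \<le> 0"
proof -
  have "cosh r * (cosh r * t) = sinh r * (sinh r * t) + t" for t
    unfolding mult.assoc[symmetric] cosh_square_r by (simp add: distrib_right)
  then have "sinh r * lorentz m (hvec x)
      = cosh r * lorentz (hvec q) (hvec x) - lorentz (hvec p) (hvec x)"
    by (simp add: q m lorentz_simps right_diff_distrib)
  moreover have "- lorentz (hvec p) (hvec x) \<le> cosh r"
    using dist_hyp_le_iff[of r p x] r assms by simp
  moreover have "cosh r * 1 \<le> cosh r * (- lorentz (hvec q) (hvec x))"
    using cosh_r by (intro mult_left_mono hvec_lorentz_ge_1) auto
  ultimately have "sinh r * lorentz m (hvec x) \<le> 0" by simp
  then show ?thesis using sinh_r by (simp add: mult_le_0_iff)
qed

end

theorem theorem2: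
  fixes C :: "'a::euclidean_space hyp_space set" and \<delta> :: real
  assumes "complete_body C" and "diameter C = \<delta>"
  shows "constant_width \<delta> C"
proof -
  have body: "convex_body C" and complete: "diameter_complete C"
    using assms(1) by (auto simp: complete_body_def)
  have dist_le: "dist x y \<le> \<delta>" if "x \<in> C" "y \<in> C" for x y
    using complete that assms(2) diameter_bounded_bound[of C x y]
    by (auto simp: diameter_complete_def)
  have "width H C = \<delta>" if supp: "H supports C" for H
  proof -
    obtain n p where H: "H = {x. lorentz n (hvec x) = 0}" and nn: "lorentz n n = 1"
      and p: "p \<in> C" "p \<in> H" and half: "\<And>x. x \<in> C \<Longrightarrow> lorentz n (hvec x) \<le> 0"
      using supports_unit_normal[OF supp] by blast
    have np: "lorentz n (hvec p) = 0" using p(2) H by simp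
    have \<delta>: "\<delta> > 0" using convex_body_diameter_pos[OF body p(1) np nn] assms(2) by simp
    \<comment> \<open>The parameter is negative because \<open>n\<close> points out of
      \<open>C\<close>.\<close>
    obtain q where q: "hvec q = cosh \<delta> *\<^sub>R hvec p - sinh \<delta> *\<^sub>R n"
      using hvec_geodesic[OF np nn, of "- \<delta>"] by auto
    have qC: "q \<in> C"
      using diameter_complete_inner_normal_point[OF complete p(1) _ np nn half] \<delta> q assms(2)
      by simp
    define m where "m = sinh \<delta> *\<^sub>R hvec p - cosh \<delta> *\<^sub>R n"
    interpret common_perpendicular p q n m \<delta>
      using \<delta> np nn q m_def by unfold_locales
    define G where "G = {x. lorentz m (hvec x) = 0}"
    have "m \<noteq> 0" using m_m by (auto simp: lorentz_def)
    then have "hyperplane G" unfolding G_def using m_q by (rule hyperplane_lorentz_orthogonal)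
    moreover have "q \<in> G \<inter> C" using m_q qC by (simp add: G_def)
    moreover have "C \<subseteq> {x. lorentz m (hvec x) \<le> 0}"
      using cball_half_space dist_le[OF p(1)] by blast
    ultimately have G: "G supports C" unfolding supports_def G_def by blast
    have "setdist H (ARG_MAX (setdist H) K. K supports C \<and> ultraparallel H K) = setdist H G"
    proof (rule arg_max_equality)
      show "G supports C \<and> ultraparallel H G"
        using G hyperplanes_ultraparallel H G_def by simp
      fix K assume "K supports C \<and> ultraparallel H K"
      then obtain k where "k \<in> K" "k \<in> C" unfolding supports_def by blast
      \<comment> \<open>The contact points \<open>p\<close> of \<open>H\<close> and \<open>k\<close>
        of \<open>K\<close> both lie in \<open>C\<close>.\<close>
      then have "setdist H K \<le> \<delta>"
        using setdist_le_dist[OF p(2), of k K] dist_le[OF p(1), of k] by linarith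
      then show "setdist H K \<le> setdist H G"
        using setdist_hyperplanes by (simp add: H G_def)
    qed
    then show ?thesis
      using setdist_hyperplanes by (simp add: width_def H G_def)
  qed
  with body show ?thesis by (simp add: constant_width_def)
qed

end
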